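(* For all integers $n,k$ with $n\ge k\ge 2$, \[ m(n,k)\ge \frac{n(n-1)}{k(k-1)}. \]
   Context: A hypergraph is an ordered pair $(X,H)$ such that $X$ is a set and $H$ is a family of subsets of $X$; elements of $X$ are its vertices and members of $H$ are its edges (edges may have arbitrary sizes). For any two distinct vertices $u,v$ of a hypergraph $(X,H)$, the line $\overline{uv}$ is the set $\{u,v\}\cup\{p\in X:\ \exists\, T\in H \text{ with } \{u,v,p\}\subseteq T\}$. The lines of the hypergraph are all the sets $\overline{uv}$ with $u,v$ distinct vertices; the number of lines is the number of distinct such sets. For integers $n,k$, $m(n,k)$ denotes the smallest number of (distinct) lines in a hypergraph on $n$ vertices where every line consists of at most $k$ vertices. *)

theory Defs
  imports Complex_Main
begin

definition hypergraph :: "'a set \<Rightarrow> 'a set set \<Rightarrow> bool" where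
  "hypergraph X H \<longleftrightarrow> (\<forall>T\<in>H. T \<subseteq> X)"

definition line :: "'a set \<Rightarrow> 'a set set \<Rightarrow> 'a \<Rightarrow> 'a \<Rightarrow> 'a set" where
  "line X H u v = {u, v} \<union> {p \<in> X. \<exists>T\<in>H. {u, v, p} \<subseteq> T}"

definition lines :: "'a set \<Rightarrow> 'a set set \<Rightarrow> 'a set set" where
  "lines X H = {line X H u v | u v. u \<in> X \<and> v \<in> X \<and> u \<noteq> v}"

definition admissible :: "nat \<Rightarrow> nat \<Rightarrow> 'a set \<Rightarrow> 'a set set \<Rightarrow> bool" where
  "admissible n k X H \<longleftrightarrow>
     hypergraph X H \<and> finite X \<and> card X = n \<and> (\<forall>L\<in>lines X H. card L \<le> k)"

text \<open>
  HOL cannot quantify over all types inside a definition, so the minimum ranges over hypergraphs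
  whose vertices are natural numbers. The lemma \<open>m_le_card_lines\<close> shows that nothing is lost: the
  value is a lower bound for hypergraphs over any vertex type. The lemma \<open>m_attained\<close> shows that,
  for \<open>k \<ge> 2\<close>, the minimum is over a nonempty set and is attained.
\<close>

definition m :: "nat \<Rightarrow> nat \<Rightarrow> nat" where
  "m n k = (LEAST l. \<exists>(X :: nat set) H. admissible n k X H \<and> card (lines X H) = l)"

lemma line_image:
  assumes "inj_on f X" "hypergraph X H" "u \<in> X" "v \<in> X"
  shows "line (f ` X) ((`) f ` H) (f u) (f v) = f ` line X H u v"
proof -
  have *: "f w \<in> f ` T \<longleftrightarrow> w \<in> T" if "w \<in> X" "T \<in> H" for w T
    using inj_on_image_mem_iff[OF assms(1) that(1)] assms(2) that(2)
    unfolding hypergraph_def by blast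
  have "(\<exists>S\<in>(`) f ` H. {f u, f v, f p} \<subseteq> S) \<longleftrightarrow> (\<exists>T\<in>H. {u, v, p} \<subseteq> T)" if "p \<in> X" for p
  proof -
    have "{f u, f v, f p} \<subseteq> f ` T \<longleftrightarrow> {u, v, p} \<subseteq> T" if "T \<in> H" for T
      using *[OF assms(3) that] *[OF assms(4) that] *[OF \<open>p \<in> X\<close> that]
      by (simp only: insert_subset empty_subsetI)
    then show ?thesis
      unfolding bex_simps(7) by (rule bex_cong[OF refl])
  qed
  then have "{p \<in> X. \<exists>S\<in>(`) f ` H. {f u, f v, f p} \<subseteq> S} = {p \<in> X. \<exists>T\<in>H. {u, v, p} \<subseteq> T}"
    by (intro Collect_cong conj_cong refl)
  moreover have "{q \<in> f ` X. Q q} = f ` {p \<in> X. Q (f p)}" for Q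
    by blast
  ultimately have "{q \<in> f ` X. \<exists>S\<in>(`) f ` H. {f u, f v, q} \<subseteq> S} =
        f ` {p \<in> X. \<exists>T\<in>H. {u, v, p} \<subseteq> T}"
    by (simp only:)
  then show ?thesis
    by (simp only: line_def image_Un image_insert image_empty)
qed

lemma line_subset: "u \<in> X \<Longrightarrow> v \<in> X \<Longrightarrow> line X H u v \<subseteq> X"
  by (auto simp: line_def)

lemma lines_image:
  assumes "inj_on f X" "hypergraph X H"
  shows "lines (f ` X) ((`) f ` H) = (`) f ` lines X H"
proof -
  have "lines (f ` X) ((`) f ` H) =
        {line (f ` X) ((`) f ` H) (f u) (f v) | u v. u \<in> X \<and> v \<in> X \<and> u \<noteq> v}"
    using inj_on_eq_iff[OF assms(1)] unfolding lines_def by fast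
  also have "\<dots> = {f ` line X H u v | u v. u \<in> X \<and> v \<in> X \<and> u \<noteq> v}"
    by (simp add: line_image[OF assms] cong: rev_conj_cong)
  also have "\<dots> = (`) f ` lines X H"
    unfolding lines_def by blast
  finally show ?thesis .
qed

lemma m_le_card_lines:
  fixes X :: "'a set"
  assumes "admissible n k X H"
  shows "m n k \<le> card (lines X H)"
proof -
  have fin: "finite X" and hyp: "hypergraph X H"
    using assms by (auto simp: admissible_def)
  have "\<exists>(f :: 'a \<Rightarrow> nat) n. f ` X = {i. i < n} \<and> inj_on f X"
    using fin by (rule finite_imp_inj_to_nat_seg)
  then obtain f :: "'a \<Rightarrow> nat" where f: "inj_on f X"
    by (elim exE conjE)
  have sub: "L \<subseteq> X" if L: "L \<in> lines X H" for L
  proof -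
    obtain u v where "u \<in> X" "v \<in> X" "L = line X H u v"
      using L unfolding lines_def by blast
    then show ?thesis
      by (simp add: line_subset)
  qed
  have inj: "inj_on ((`) f) (lines X H)"
    using inj_on_image_eq_iff[OF f sub sub] by (intro inj_onI) simp
  have card: "card (f ` L) = card L" if "L \<in> lines X H" for L
    using card_image[OF inj_on_subset[OF f sub[OF that]]] .
  have "admissible n k (f ` X) ((`) f ` H)"
    using assms card card_image[OF f]
    by (auto simp: admissible_def lines_image[OF f hyp] hypergraph_def)
  moreover have "card (lines (f ` X) ((`) f ` H)) = card (lines X H)"
    by (simp add: lines_image[OF f hyp] card_image[OF inj])
  ultimately have "\<exists>(Y :: nat set) G. admissible n k Y G \<and> card (lines Y G) = card (lines X H)"
    by blast
  then show ?thesis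
    unfolding m_def by (rule Least_le)
qed

lemma m_attained:
  assumes "2 \<le> k"
  shows "\<exists>(X :: nat set) H. admissible n k X H \<and> card (lines X H) = m n k"
proof -
  have "card (line {..<n} {} u v) \<le> k" for u v
    using assms card_insert_le_m1[of 2 "{v}" u] by (simp add: line_def)
  then have "admissible n k {..<n} {}"
    by (auto simp: admissible_def hypergraph_def lines_def)
  then have "\<exists>l. \<exists>(X :: nat set) H. admissible n k X H \<and> card (lines X H) = l"
    by blast
  from LeastI_ex[OF this] show ?thesis
    unfolding m_def .
qed

end

theory Submission
  imports Defs
begin

text \<open>
  Double counting: a line contains both points of every pair that generates it, so a line with at
  most \<open>k\<close> points is generated by at most \<open>k (k - 1)\<close> of the \<open>n (n - 1)\<close> ordered pairs of distinct
  vertices.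
\<close>

text \<open>\<open>SIGMA u:A. A - {u}\<close> encodes the ordered pairs of distinct elements of
  \<open>A\<close>. Truncated subtraction is harmless for empty \<open>A\<close>, where the factor
  \<open>card A\<close> vanishes.\<close>

lemma card_Sigma_remove:
  assumes "finite A"
  shows "card (SIGMA u:A. A - {u}) = card A * (card A - 1)"
  using assms by (simp add: card_Diff_singleton)

lemma card_lines_ge:
  assumes "admissible n k X H"
  shows "n * (n - 1) \<le> card (lines X H) * (k * (k - 1))"
proof -
  have fin: "finite X" and n: "card X = n" and le: "\<And>L. L \<in> lines X H \<Longrightarrow> card L \<le> k"
    using assms by (auto simp: admissible_def)
  have sub: "lines X H \<subseteq> Pow X"
    using line_subset unfolding lines_def by fast
  then have fin_lines: "finite (lines X H)"
    using fin by (simp add: finite_subset)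
  have finL: "finite L" if "L \<in> lines X H" for L
    using that sub fin by (blast intro: finite_subset)
  \<comment> \<open>Each pair lies in the line it generates. The right side collects all pairs
    inside a line, not only the generating ones, so its parts may overlap; a covering is
    enough.\<close>
  have "(SIGMA u:X. X - {u}) \<subseteq> (\<Union>L\<in>lines X H. SIGMA u:L. L - {u})"
  proof (rule subrelI)
    fix u v assume "(u, v) \<in> (SIGMA u:X. X - {u})"
    then have "u \<in> X" "v \<in> X" "v \<noteq> u"
      by simp_all
    then have "line X H u v \<in> lines X H"
      unfolding lines_def by blast
    moreover have "u \<in> line X H u v" "v \<in> line X H u v"
      by (simp_all add: line_def)
    ultimately show "(u, v) \<in> (\<Union>L\<in>lines X H. SIGMA u:L. L - {u})"
      using \<open>v \<noteq> u\<close> by blast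
  qed
  then have "card (SIGMA u:X. X - {u}) \<le> card (\<Union>L\<in>lines X H. SIGMA u:L. L - {u})"
    using fin_lines finL by (intro card_mono) auto
  also have "\<dots> \<le> (\<Sum>L\<in>lines X H. card (SIGMA u:L. L - {u}))"
    by (rule card_UN_le[OF fin_lines])
  \<comment> \<open>The map sending \<open>c\<close> to \<open>c * (c - 1)\<close> is monotone on
    \<open>nat\<close>, so \<open>card L \<le> k\<close> bounds each term.\<close>
  also have "\<dots> \<le> (\<Sum>L\<in>lines X H. k * (k - 1))"
    using le finL by (intro sum_mono) (simp only: card_Sigma_remove mult_le_mono diff_le_mono)
  finally show ?thesis
    by (simp only: card_Sigma_remove[OF fin] n sum_constant of_nat_id)
qed

theorem theorem5:
  fixes n k :: nat
  assumes "n \<ge> k" and "k \<ge> 2"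
  shows "real (m n k) \<ge> real n * (real n - 1) / (real k * (real k - 1))"
proof -
  \<comment> \<open>A minimiser turns the bound for one hypergraph into a bound on
    \<open>m n k\<close>.\<close>
  obtain X :: "nat set" and H where "admissible n k X H" "card (lines X H) = m n k"
    using m_attained[OF assms(2)] by blast
  then have "n * (n - 1) \<le> m n k * (k * (k - 1))"
    using card_lines_ge by metis
  then have "real (n * (n - 1)) \<le> real (m n k * (k * (k - 1)))"
    by (simp only: of_nat_le_iff)
  \<comment> \<open>Since \<open>n \<ge> k \<ge> 2\<close>, neither \<open>n - 1\<close> nor
    \<open>k - 1\<close> is truncated, so both agree with real subtraction.\<close>
  then have "real n * (real n - 1) \<le> real (m n k) * (real k * (real k - 1))"
    using assms by (simp add: of_nat_diff)
  moreover have "0 < real k * (real k - 1)"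
    using assms(2) by simp
  ultimately show ?thesis
    by (simp add: pos_divide_le_eq)
qed

end
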